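(* Let $\{Q_p(x)\}_{p\ge0}$ be a sequence of orthogonal polynomials satisfying $Q_{p+1}(x)=S_p(x)Q_p(x)-C_pQ_{p-1}(x)$ for all $p\ge1$, where $S_p(x)=A_px+B_p$ and the Favard coefficients $A_p,B_p,C_p$ are as in the context. Put $T_p(x)=S_p(x)/C_p$ and $D_p=1/C_p$ for $p\ge1$. Then for all integers $t\ge1$ and $p\ge t$ (and all real $x$), $$Q_{p-t}(x)=\psi_{p-t}^{(p)}(x)Q_p(x)+\psi_{p-t}^{(p-1)}(x)Q_{p-1}(x),$$ where the coefficients are determined by $\psi_{p-1}^{(p)}(x)=0$, $\psi_{p-1}^{(p-1)}(x)=1$, $\psi_{p-2}^{(p)}(x)=-D_{p-1}$, $\psi_{p-2}^{(p-1)}(x)=T_{p-1}(x)$, and, for $t\ge3$, $$\begin{bmatrix}\psi_{p-t}^{(p-1)}(x)\\ \psi_{p-t}^{(p)}(x)\end{bmatrix}=\begin{bmatrix}\psi_{p-t+1}^{(p-1)}(x)&\psi_{p-t+2}^{(p-1)}(x)\\ \psi_{p-t+1}^{(p)}(x)&\psi_{p-t+2}^{(p)}(x)\end{bmatrix}\begin{bmatrix}T_{p-t+1}(x)\\-D_{p-t+1}\end{bmatrix}.$$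
   Context: The sequence is given by Favard's recurrence $Q_{p+1}(x)=(A_px+B_p)Q_p(x)-C_pQ_{p-1}(x)$ for $p\ge0$, with $Q_0(x)=1$, $Q_{-1}(x)=0$, where $(A_p),(B_p),(C_p)$ are real sequences with $A_p\ne0$ for all $p\ge 0$, and $C_p\neq 0$ and $C_pA_pA_{p-1}>0$ for all $p\ge 1$ ($C_0$ is irrelevant since $Q_{-1}=0$). *)

theory Defs
  imports "HOL-Analysis.Analysis" "HOL-Computational_Algebra.Polynomial"
begin

text \<open>Orthogonality is with respect to a positive moment functional \<open>L\<close> on polynomials;
  integration against a positive measure with finite moments and infinite support is a
  special case.\<close>

definition orthogonal_polynomials :: "(real poly \<Rightarrow> real) \<Rightarrow> (nat \<Rightarrow> real poly) \<Rightarrow> bool" where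
  "orthogonal_polynomials L Q \<longleftrightarrow>
     Vector_Spaces.linear smult (*) L \<and>
     (\<forall>n. degree (Q n) = n) \<and>
     (\<forall>m n. m \<noteq> n \<longrightarrow> L (Q m * Q n) = 0) \<and>
     (\<forall>n. L (Q n * Q n) > 0)"

definition favard_S :: "(nat \<Rightarrow> real) \<Rightarrow> (nat \<Rightarrow> real) \<Rightarrow> nat \<Rightarrow> real poly" where
  "favard_S A B p = [:B p, A p:]"

definition favard_coeffs :: "(nat \<Rightarrow> real) \<Rightarrow> (nat \<Rightarrow> real) \<Rightarrow> bool" where
  "favard_coeffs A C \<longleftrightarrow>
     (\<forall>p. A p \<noteq> 0) \<and> (\<forall>p\<ge>1. C p \<noteq> 0 \<and> C p * A p * A (p - 1) > 0)"

text \<open>The step at index \<open>0\<close> is separate because \<open>Q\<^sub>-\<^sub>1 = 0\<close>; the value \<open>C 0\<close> is never used.\<close>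

definition favard_recurrence ::
  "(nat \<Rightarrow> real) \<Rightarrow> (nat \<Rightarrow> real) \<Rightarrow> (nat \<Rightarrow> real) \<Rightarrow> (nat \<Rightarrow> real poly) \<Rightarrow> bool" where
  "favard_recurrence A B C Q \<longleftrightarrow>
     Q 0 = 1 \<and>
     Q 1 = favard_S A B 0 * Q 0 \<and>
     (\<forall>p\<ge>1. Q (p + 1) = favard_S A B p * Q p - smult (C p) (Q (p - 1)))"

definition favard_T :: "(nat \<Rightarrow> real) \<Rightarrow> (nat \<Rightarrow> real) \<Rightarrow> (nat \<Rightarrow> real) \<Rightarrow> nat \<Rightarrow> real \<Rightarrow> real" where
  "favard_T A B C p x = poly (favard_S A B p) x / C p"

definition favard_D :: "(nat \<Rightarrow> real) \<Rightarrow> nat \<Rightarrow> real" where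
  "favard_D C p = 1 / C p"

text \<open>\<open>psi A B C x p t\<close> is the column vector with entries \<open>\<psi>\<^bsub>p-t\<^esub>\<^bsup>(p-1)\<^esup>(x)\<close> (component 1) and
  \<open>\<psi>\<^bsub>p-t\<^esub>\<^bsup>(p)\<^esup>(x)\<close> (component 2). The pivot \<open>p\<close> has to be an argument of its own: a lower and an
  upper index do not determine the coefficient, since upper index \<open>q\<close> occurs both for \<open>p = q\<close>
  and for \<open>p = q + 1\<close>, with different values. The coefficients are meant for \<open>1 \<le> t \<le> p\<close> only
  (so that subtraction on \<open>nat\<close> does not truncate); there is no equation for \<open>t = 0\<close>.
  The transposed matrix has \<open>psi A B C x p (t - 1)\<close> and \<open>psi A B C x p (t - 2)\<close> as its columns.\<close>

fun psi :: "(nat \<Rightarrow> real) \<Rightarrow> (nat \<Rightarrow> real) \<Rightarrow> (nat \<Rightarrow> real) \<Rightarrow> real \<Rightarrow> nat \<Rightarrow> nat \<Rightarrow> real ^ 2" where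
  "psi A B C x p (Suc 0) = vector [1, 0]"
| "psi A B C x p (Suc (Suc 0)) = vector [favard_T A B C (p - 1) x, - favard_D C (p - 1)]"
| "psi A B C x p (Suc (Suc (Suc t))) =
     (transpose (vector [psi A B C x p (Suc (Suc t)), psi A B C x p (Suc t)]) :: real ^ 2 ^ 2) *v
     vector [favard_T A B C (p - Suc (Suc t)) x, - favard_D C (p - Suc (Suc t))]"

definition psi_prev ::
  "(nat \<Rightarrow> real) \<Rightarrow> (nat \<Rightarrow> real) \<Rightarrow> (nat \<Rightarrow> real) \<Rightarrow> real \<Rightarrow> nat \<Rightarrow> nat \<Rightarrow> real" where
  "psi_prev A B C x p t = psi A B C x p t $ 1"

definition psi_top ::
  "(nat \<Rightarrow> real) \<Rightarrow> (nat \<Rightarrow> real) \<Rightarrow> (nat \<Rightarrow> real) \<Rightarrow> real \<Rightarrow> nat \<Rightarrow> nat \<Rightarrow> real" where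
  "psi_top A B C x p t = psi A B C x p t $ 2"

end

theory Submission
  imports Defs
begin

text \<open>
  Since \<open>C q \<noteq> 0\<close>, the three-term recurrence can be solved for its lowest term, giving the
  downward recurrence \<open>Q (q - 1) = T q * Q q - D q * Q (q + 1)\<close> for \<open>q \<ge> 1\<close>
  (lemma \<open>favard_recurrence_backward\<close>). Starting from the pair \<open>Q p\<close>, \<open>Q (p - 1)\<close>, it expresses
  every lower polynomial as a combination of that pair. The coefficients obey the same linear
  recurrence (lemma \<open>psi_step\<close>), and induction on the distance from \<open>p\<close> gives the claim.
\<close>

lemma favard_recurrence_backward:
  assumes "favard_coeffs A C" and "favard_recurrence A B C Q" and "q \<ge> 1"
  shows "poly (Q (q - 1)) x =
           favard_T A B C q x * poly (Q q) x - favard_D C q * poly (Q (q + 1)) x"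
proof -
  have "C q \<noteq> 0"
    using assms(1,3) by (simp add: favard_coeffs_def)
  moreover have "Q (q + 1) = favard_S A B q * Q q - smult (C q) (Q (q - 1))"
    using assms(2,3) by (simp add: favard_recurrence_def)
  then have "poly (Q (q + 1)) x = poly (favard_S A B q) x * poly (Q q) x - C q * poly (Q (q - 1)) x"
    by simp
  ultimately show ?thesis
    by (simp add: favard_T_def favard_D_def field_simps)
qed

text \<open>Multiplying a matrix by a vector combines its columns, so each component of
  \<open>psi\<close> runs through the downward recurrence on its own.\<close>

lemma psi_step:
  "psi A B C x p (Suc (Suc (Suc t))) $ i =
     favard_T A B C (p - Suc (Suc t)) x * psi A B C x p (Suc (Suc t)) $ i
     - favard_D C (p - Suc (Suc t)) * psi A B C x p (Suc t) $ i"
  by (simp add: matrix_vector_mult_def transpose_def sum_2 mult.commute)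

theorem theorem3:
  fixes A B C :: "nat \<Rightarrow> real" and Q :: "nat \<Rightarrow> real poly"
    and L :: "real poly \<Rightarrow> real" and t p :: nat and x :: real
  assumes "favard_coeffs A C"
    and "favard_recurrence A B C Q"
    and "orthogonal_polynomials L Q"
    and "t \<ge> 1" and "p \<ge> t"
  shows "poly (Q (p - t)) x =
           psi_top A B C x p t * poly (Q p) x + psi_prev A B C x p t * poly (Q (p - 1)) x"
proof -
  note backward = favard_recurrence_backward[OF assms(1,2), where x = x]
  show ?thesis
    using assms(4,5)
  proof (induction t rule: induct_nat_012)
    case 0
    then show ?case
      by simp
  next
    case 1
    then show ?case
      by (simp add: psi_top_def psi_prev_def)
  next
    case (ge2 s)
    show ?case
    \<comment> \<open>At distance two the hypothesis for \<open>s = 0\<close> is vacuous, as \<open>psi\<close> starts at distance one;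
      there the downward recurrence at \<open>p - 1\<close> is itself the claim.\<close>
    proof (cases s)
      case 0
      then have "p - 1 \<ge> 1" "p - 1 - 1 = p - 2" "p - 1 + 1 = p"
        using ge2.prems by auto
      with backward[of "p - 1"] 0 show ?thesis
        by (simp add: psi_top_def psi_prev_def numeral_2_eq_2)
    next
      case (Suc r)
      define q where "q = p - Suc s"
      have q: "q \<ge> 1" "q - 1 = p - Suc (Suc s)" "q + 1 = p - s"
        using ge2.prems by (auto simp: q_def)
      have "poly (Q (p - Suc (Suc s))) x =
              favard_T A B C q x * poly (Q (p - Suc s)) x - favard_D C q * poly (Q (p - s)) x"
        using backward[of q] q q_def by metis
      also have "\<dots> = favard_T A B C q x *
              (psi_top A B C x p (Suc s) * poly (Q p) x + psi_prev A B C x p (Suc s) * poly (Q (p - 1)) x)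
            - favard_D C q *
              (psi_top A B C x p s * poly (Q p) x + psi_prev A B C x p s * poly (Q (p - 1)) x)"
        using ge2.IH ge2.prems Suc by simp
      also have "\<dots> = psi_top A B C x p (Suc (Suc s)) * poly (Q p) x
            + psi_prev A B C x p (Suc (Suc s)) * poly (Q (p - 1)) x"
        unfolding psi_top_def psi_prev_def Suc psi_step q_def by (simp only: algebra_simps)
      finally show ?thesis .
    qed
  qed
qed

end
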